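(* Let $\Gamma_1$ and $\Gamma_2$ be subgraphs of a finite loopless graph $\Gamma$ (multiple edges allowed) such that $\Gamma=\Gamma_1\cup\Gamma_2$, $|E(\Gamma_1)\cap E(\Gamma_2)|\le 3$, and the edge set $E(\Gamma_1)\cap E(\Gamma_2)$ induces a connected subgraph of $\Gamma$. If both $\Gamma_1$ and $\Gamma_2$ admit nowhere-zero $4$-flows, then $\Gamma$ admits a nowhere-zero $4$-flow.
   Context: An orientation $\mathcal D$ of a graph assigns each edge one of its two directions; $\mathcal D^+(v)$ (resp. $\mathcal D^-(v)$) is the set of edges with tail (resp. head) at $v$. A nowhere-zero $4$-flow is a pair $(\mathcal D,\varphi)$ with $\varphi:E(\Gamma)\to\mathbb Z$, $0<|\varphi(e)|<4$ for all edges $e$, and $\sum_{e\in\mathcal D^+(v)}\varphi(e)=\sum_{e\in\mathcal D^-(v)}\varphi(e)$ for every vertex $v$; equivalently one may use $\mathbb Z_4$-valued nowhere-zero flows. The subgraph induced by an edge set consists of those edges together with their end vertices. *)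

theory Defs
  imports "Graph_Theory.Digraph"
begin

text \<open>Undirected multigraphs. Edges are named objects, so distinct edges may have the same set
  of end vertices; the values of \<open>ends\<close> outside \<open>edges\<close> are irrelevant.\<close>

record ('v, 'e) multigraph =
  vertices :: "'v set"
  edges :: "'e set"
  ends :: "'e \<Rightarrow> 'v set"

definition finite_loopless_multigraph :: "('v, 'e) multigraph \<Rightarrow> bool" where
  "finite_loopless_multigraph G \<longleftrightarrow>
     finite (vertices G) \<and> finite (edges G) \<and>
     (\<forall>e \<in> edges G. ends G e \<subseteq> vertices G \<and> card (ends G e) = 2)"

definition is_subgraph :: "('v, 'e) multigraph \<Rightarrow> ('v, 'e) multigraph \<Rightarrow> bool" where
  "is_subgraph H G \<longleftrightarrow>
     vertices H \<subseteq> vertices G \<and> edges H \<subseteq> edges G \<and>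
     (\<forall>e \<in> edges H. ends H e = ends G e \<and> ends H e \<subseteq> vertices H)"

text \<open>For \<open>H1\<close>, \<open>H2\<close> subgraphs of \<open>G\<close>, whose end maps therefore agree with that of \<open>G\<close>.\<close>

definition is_union_of ::
  "('v, 'e) multigraph \<Rightarrow> ('v, 'e) multigraph \<Rightarrow> ('v, 'e) multigraph \<Rightarrow> bool" where
  "is_union_of G H1 H2 \<longleftrightarrow>
     vertices G = vertices H1 \<union> vertices H2 \<and> edges G = edges H1 \<union> edges H2"

definition edge_induced_subgraph :: "('v, 'e) multigraph \<Rightarrow> 'e set \<Rightarrow> ('v, 'e) multigraph" where
  "edge_induced_subgraph G F = \<lparr>vertices = (\<Union>e \<in> F. ends G e), edges = F, ends = ends G\<rparr>"

definition adjacency :: "('v, 'e) multigraph \<Rightarrow> ('v \<times> 'v) set" where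
  "adjacency G = {(u, w). \<exists>e \<in> edges G. ends G e = {u, w}}"

text \<open>The null graph counts as connected.\<close>

definition connected_multigraph :: "('v, 'e) multigraph \<Rightarrow> bool" where
  "connected_multigraph G \<longleftrightarrow>
     (\<forall>u \<in> vertices G. \<forall>w \<in> vertices G. (u, w) \<in> (adjacency G)\<^sup>*)"

text \<open>An orientation of \<open>G\<close> is a digraph on the vertices of \<open>G\<close> whose arcs are the edges
  of \<open>G\<close> themselves; \<open>\<D>\<^sup>+(v)\<close> and \<open>\<D>\<^sup>-(v)\<close> are then
  \<^const>\<open>out_arcs\<close> and \<^const>\<open>in_arcs\<close>.\<close>

definition is_orientation :: "('v, 'e) pre_digraph \<Rightarrow> ('v, 'e) multigraph \<Rightarrow> bool" where
  "is_orientation D G \<longleftrightarrow>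
     verts D = vertices G \<and> arcs D = edges G \<and>
     (\<forall>e \<in> edges G. ends G e = {tail D e, head D e})"

definition nowhere_zero_4_flow ::
  "('v, 'e) multigraph \<Rightarrow> ('v, 'e) pre_digraph \<Rightarrow> ('e \<Rightarrow> int) \<Rightarrow> bool" where
  "nowhere_zero_4_flow G D \<phi> \<longleftrightarrow>
     is_orientation D G \<and>
     (\<forall>e \<in> edges G. 0 < \<bar>\<phi> e\<bar> \<and> \<bar>\<phi> e\<bar> < 4) \<and>
     (\<forall>v \<in> vertices G. (\<Sum>e \<in> out_arcs D v. \<phi> e) = (\<Sum>e \<in> in_arcs D v. \<phi> e))"

definition admits_nowhere_zero_4_flow :: "('v, 'e) multigraph \<Rightarrow> bool" where
  "admits_nowhere_zero_4_flow G \<longleftrightarrow> (\<exists>D \<phi>. nowhere_zero_4_flow G D \<phi>)"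

end

theory Submission
  imports Defs "HOL-Library.Z2" "HOL-Library.Product_Plus"
begin

text \<open>
  A nowhere-zero 4-flow amounts to a nowhere-zero flow with values in \<open>\<int>\<^sub>2 \<times> \<int>\<^sub>2\<close> (``colours''), i.e.
  to two even edge sets covering all edges. Given such flows \<open>f1\<close>, \<open>f2\<close> on the two subgraphs, extended
  by zero, one looks for an automorphism \<open>\<sigma>\<close> of \<open>\<int>\<^sub>2 \<times> \<int>\<^sub>2\<close> with \<open>\<sigma> (f2 e) \<noteq> f1 e\<close> on every common
  edge, so that \<open>f1 + \<sigma> \<circ> f2\<close> is nowhere zero. This fails only if there are three common edges on
  which one flow, say \<open>f1\<close>, is injective and the other is constant.

  In that case one of the flows is first modified, zeros on common edges now being permitted.
  If the common edges contain a cycle, add the constant along it to \<open>f2\<close>, which then vanishes there.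
  Otherwise they form a star or a path. For a colour \<open>d\<close>, the edges with colour outside \<open>{0, d}\<close>
  form an even set; after removing the common edges, the odd vertices of this set are the four
  vertices of the tree (\<open>d\<close> is any colour other than the constant for a star and flow \<open>f2\<close>, and the
  colour of the middle edge for a path and flow \<open>f1\<close>). A trail in it from the centre of the star, or
  from an end of the path, to another vertex of the tree closes up along the tree, and adding \<open>d\<close>
  along the resulting even set makes \<open>f2\<close> non-constant on the star, respectively makes \<open>f1\<close> miss
  a nonzero colour on the path.
\<close>

section \<open>Parity of edge sets\<close>

text \<open>The support of the boundary of \<open>H\<close> over the field with two elements; a
  finite \<open>H\<close> is in the cycle space iff this set is empty.\<close>

definition odd_vertices :: "('v, 'e) multigraph \<Rightarrow> 'e set \<Rightarrow> 'v set" where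
  "odd_vertices G H = {v. odd (card {e \<in> H. v \<in> ends G e})}"

text \<open>No orientation enters: colours satisfy \<open>x = -x\<close>, so on loopless graphs the
  sum over incident edges is the net flow.\<close>

definition boundary :: "('v, 'e) multigraph \<Rightarrow> ('e \<Rightarrow> 'k::comm_monoid_add) \<Rightarrow> 'v \<Rightarrow> 'k" where
  "boundary G f v = (\<Sum>e \<in> edges G. if v \<in> ends G e then f e else 0)"

lemma odd_vertices_empty [simp]: "odd_vertices G {} = {}"
  by (simp add: odd_vertices_def)

lemma odd_vertices_insert:
  assumes "finite H" and "e \<notin> H"
  shows "v \<in> odd_vertices G (insert e H) \<longleftrightarrow> (v \<in> odd_vertices G H) \<noteq> (v \<in> ends G e)"
proof (cases "v \<in> ends G e")
  case True
  then have "{e' \<in> insert e H. v \<in> ends G e'} = insert e {e' \<in> H. v \<in> ends G e'}" by auto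
  then show ?thesis using assms True by (simp add: odd_vertices_def)
next
  case False
  then have "{e' \<in> insert e H. v \<in> ends G e'} = {e' \<in> H. v \<in> ends G e'}" by auto
  then show ?thesis using False by (simp add: odd_vertices_def)
qed

lemma odd_vertices_remove:
  assumes "finite H" and "e \<in> H"
  shows "v \<in> odd_vertices G (H - {e}) \<longleftrightarrow> (v \<in> odd_vertices G H) \<noteq> (v \<in> ends G e)"
  using odd_vertices_insert[of "H - {e}" e v G] assms by (auto simp: insert_absorb)

lemma odd_vertex_incident:
  assumes "u \<in> odd_vertices G H"
  obtains e where "e \<in> H" and "u \<in> ends G e"
proof -
  have "{e \<in> H. u \<in> ends G e} \<noteq> {}"
    using assms unfolding odd_vertices_def by (metis (mono_tags) card.empty even_zero mem_Collect_eq)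
  then show ?thesis using that by auto
qed

lemma card_two_other:
  assumes "card A = 2" and "u \<in> A"
  obtains z where "A = {u, z}" and "z \<noteq> u"
  using assms by (auto simp: card_2_iff)

text \<open>Walk away from \<open>u\<close>, deleting each edge traversed. If the far end
  \<open>z\<close> was not odd, the deletion makes it odd and the walk goes on; by finiteness it
  stops at another odd vertex.\<close>

lemma odd_vertices_trail:
  assumes "finite H" and "\<forall>e \<in> H. card (ends G e) = 2" and "u \<in> odd_vertices G H"
  shows "\<exists>J y. J \<subseteq> H \<and> y \<in> odd_vertices G H \<and> y \<noteq> u \<and> odd_vertices G J = {u, y}"
  using assms
proof (induction "card H" arbitrary: H u)
  case 0
  then show ?case by simp
next
  case (Suc n)
  obtain e where e: "e \<in> H" "u \<in> ends G e"
    using Suc.prems(3) by (rule odd_vertex_incident)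
  then obtain z where z: "ends G e = {u, z}" "z \<noteq> u"
    using Suc.prems(2) card_two_other by metis
  show ?case
  proof (cases "z \<in> odd_vertices G H")
    case True
    have "odd_vertices G {e} = {u, z}"
      using odd_vertices_insert[of "{}" e _ G] z by auto
    then show ?thesis using True z e by blast
  next
    case False
    let ?H = "H - {e}"
    have odd: "v \<in> odd_vertices G ?H \<longleftrightarrow> (v \<in> odd_vertices G H) \<noteq> (v \<in> {u, z})" for v
      using odd_vertices_remove[OF Suc.prems(1) e(1)] z(1) by metis
    have "n = card ?H" using Suc.hyps(2) e(1) Suc.prems(1) by simp
    moreover have "z \<in> odd_vertices G ?H" using odd False by simp
    ultimately obtain J y where J: "J \<subseteq> ?H" "y \<in> odd_vertices G ?H" "y \<noteq> z"
        "odd_vertices G J = {z, y}"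
      using Suc.hyps(1)[of ?H z] Suc.prems by auto
    \<comment> \<open>Deleting \<open>e\<close> makes \<open>u\<close> even, so \<open>y\<close>
      differs from \<open>u\<close>; not being an end of \<open>e\<close>, \<open>y\<close> has the
      same parity in \<open>H\<close>.\<close>
    have y: "y \<in> odd_vertices G H" "y \<noteq> u" using J(2,3) odd Suc.prems(3) by auto
    have "finite J" using J(1) Suc.prems(1) by (meson finite_Diff finite_subset)
    then have "v \<in> odd_vertices G (insert e J) \<longleftrightarrow> v \<in> {u, y}" for v
      using odd_vertices_insert[of J e v G] J y z by auto
    then have "odd_vertices G (insert e J) = {u, y}" by blast
    moreover have "insert e J \<subseteq> H" using J(1) e(1) by auto
    ultimately show ?thesis using y by blast
  qed
qed

text \<open>Allowing two odd vertices \<open>u\<close>, \<open>v\<close> makes the induction on the number of edges work.\<close>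

lemma euler_signing:
  fixes t h :: "'e \<Rightarrow> 'v" and u v :: 'v
  assumes "finite H" and "\<forall>e \<in> H. ends G e = {t e, h e} \<and> t e \<noteq> h e"
    and "\<forall>w. w \<in> odd_vertices G H \<longleftrightarrow> (w = u) \<noteq> (w = v)"
  shows "\<exists>\<epsilon> :: 'e \<Rightarrow> int. (\<forall>e \<in> H. \<bar>\<epsilon> e\<bar> = 1) \<and>
    (\<forall>w. (\<Sum>e \<in> H. \<epsilon> e * (of_bool (t e = w) - of_bool (h e = w))) = of_bool (w = u) - of_bool (w = v))"
  using assms
proof (induction "card H" arbitrary: H u v)
  case 0
  then show ?case by auto
next
  case (Suc n)
  \<comment> \<open>\<open>e\<close> becomes the first edge of a trail from \<open>x\<close> to
    \<open>y\<close>. If \<open>u = v\<close>, all degrees are even and any end of any edge can be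
    the start.\<close>
  have "\<exists>e x y. e \<in> H \<and> x \<in> ends G e \<and> (x = u \<and> y = v \<or> x = y \<and> u = v)"
  proof (cases "u = v")
    case True
    have "H \<noteq> {}" using Suc.hyps(2) by auto
    then obtain e where "e \<in> H" by blast
    moreover have "t e \<in> ends G e" using Suc.prems(2) \<open>e \<in> H\<close> by simp
    ultimately show ?thesis using True by blast
  next
    case False
    then have "u \<in> odd_vertices G H" using Suc.prems(3) by simp
    then obtain e where "e \<in> H" "u \<in> ends G e" by (rule odd_vertex_incident)
    then show ?thesis by blast
  qed
  then obtain e x y where e: "e \<in> H" "x \<in> ends G e" and xy: "x = u \<and> y = v \<or> x = y \<and> u = v"
    by blast
  have th: "ends G e = {t e, h e}" "t e \<noteq> h e" using Suc.prems(2) e(1) by auto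
  then have "card (ends G e) = 2" by simp
  then obtain z where z: "ends G e = {x, z}" "z \<noteq> x"
    using e(2) by (rule card_two_other)
  then have "t e = x \<and> h e = z \<or> t e = z \<and> h e = x"
    using th by (auto simp: doubleton_eq_iff)
  note th = this
  let ?H = "H - {e}"
  have "w \<in> odd_vertices G ?H \<longleftrightarrow> (w = z) \<noteq> (w = y)" for w
    using odd_vertices_remove[OF Suc.prems(1) e(1), of w G] z Suc.prems(3) xy by auto
  moreover have "n = card ?H" using Suc.hyps(2) e(1) Suc.prems(1) by simp
  ultimately obtain \<epsilon> :: "'e \<Rightarrow> int" where \<epsilon>: "\<forall>e \<in> ?H. \<bar>\<epsilon> e\<bar> = 1"
      "\<And>w. (\<Sum>e \<in> ?H. \<epsilon> e * (of_bool (t e = w) - of_bool (h e = w))) = of_bool (w = z) - of_bool (w = y)"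
    using Suc.hyps(1)[of ?H z y] Suc.prems(1,2) by blast
  \<comment> \<open>\<open>s\<close> directs \<open>e\<close> from \<open>x\<close> to
    \<open>z\<close>; its contribution telescopes with that of the remaining edges, from
    \<open>z\<close> to \<open>y\<close>.\<close>
  define s :: int where "s = (if t e = x then 1 else -1)"
  define \<epsilon>' where "\<epsilon>' = \<epsilon>(e := s)"
  have "(\<Sum>e \<in> H. \<epsilon>' e * (of_bool (t e = w) - of_bool (h e = w))) = of_bool (w = u) - of_bool (w = v)" for w
  proof -
    have "(\<Sum>e \<in> H. \<epsilon>' e * (of_bool (t e = w) - of_bool (h e = w)))
      = s * (of_bool (t e = w) - of_bool (h e = w))
        + (\<Sum>e \<in> ?H. \<epsilon>' e * (of_bool (t e = w) - of_bool (h e = w)))"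
      using Suc.prems(1) e(1) by (subst sum.remove[of H e]) (simp_all add: \<epsilon>'_def)
    also have "(\<Sum>e \<in> ?H. \<epsilon>' e * (of_bool (t e = w) - of_bool (h e = w)))
      = (\<Sum>e \<in> ?H. \<epsilon> e * (of_bool (t e = w) - of_bool (h e = w)))"
      by (rule sum.cong) (auto simp: \<epsilon>'_def)
    also have "s * (of_bool (t e = w) - of_bool (h e = w)) = of_bool (w = x) - of_bool (w = z)"
      using z(2) th by (auto simp: s_def)
    finally show ?thesis using xy \<epsilon>(2)[of w] by auto
  qed
  moreover have "\<forall>e \<in> H. \<bar>\<epsilon>' e\<bar> = 1" using \<epsilon>(1) by (auto simp: \<epsilon>'_def s_def)
  ultimately show ?case by blast
qed

section \<open>Net flow of integer values and boundary of colours\<close>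

lemma orientation_netflow:
  fixes \<phi> :: "'e \<Rightarrow> int"
  assumes "is_orientation D G" and "finite (edges G)"
  shows "(\<Sum>e \<in> out_arcs D v. \<phi> e) - (\<Sum>e \<in> in_arcs D v. \<phi> e)
    = (\<Sum>e \<in> edges G. \<phi> e * (of_bool (tail D e = v) - of_bool (head D e = v)))"
proof -
  have "arcs D = edges G" using assms(1) by (simp add: is_orientation_def)
  then have "out_arcs D v = {e \<in> edges G. tail D e = v}" "in_arcs D v = {e \<in> edges G. head D e = v}"
    by (auto simp: out_arcs_def in_arcs_def)
  moreover have "(\<Sum>e \<in> edges G. \<phi> e * of_bool (P e)) = sum \<phi> {e \<in> edges G. P e}" for P
    unfolding sum.inter_filter[OF assms(2)] by (rule sum.cong) auto
  ultimately show ?thesis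
    by (simp add: right_diff_distrib sum_subtractf)
qed

text \<open>Modulo 2 heads and tails count alike.\<close>

lemma odd_netflow_iff:
  fixes \<phi> :: "'e \<Rightarrow> int"
  assumes "finite E" and "\<forall>e \<in> E. ends G e = {t e, h e} \<and> t e \<noteq> h e"
  shows "odd (\<Sum>e \<in> E. \<phi> e * (of_bool (t e = v) - of_bool (h e = v)))
    \<longleftrightarrow> v \<in> odd_vertices G {e \<in> E. odd (\<phi> e)}"
proof -
  have "{e \<in> E. odd (\<phi> e * (of_bool (t e = v) - of_bool (h e = v)))}
      = {e \<in> {e \<in> E. odd (\<phi> e)}. v \<in> ends G e}"
    using assms(2) by auto
  then show ?thesis using assms(1)
    by (simp add: even_sum_iff odd_vertices_def)
qed

lemma boundary_indicator:
  fixes G :: "('v, 'e) multigraph" and c :: "bit \<times> bit"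
  assumes "finite (edges G)" and "H \<subseteq> edges G"
  shows "boundary G (\<lambda>e. if e \<in> H then c else 0) v = (if v \<in> odd_vertices G H then c else 0)"
proof -
  have "boundary G (\<lambda>e. if e \<in> H then c else 0) v = (\<Sum>e \<in> edges G. if e \<in> H \<and> v \<in> ends G e then c else 0)"
    unfolding boundary_def by (rule sum.cong) auto
  also have "\<dots> = (\<Sum>e \<in> {e \<in> edges G. e \<in> H \<and> v \<in> ends G e}. c)"
    using assms(1) by (simp add: sum.inter_filter)
  also have "{e \<in> edges G. e \<in> H \<and> v \<in> ends G e} = {e \<in> H. v \<in> ends G e}"
    using assms(2) by auto
  finally have "boundary G (\<lambda>e. if e \<in> H then c else 0) v = (\<Sum>e \<in> {e \<in> H. v \<in> ends G e}. c)" .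
  moreover have "(\<Sum>e \<in> A. c) = (if odd (card A) then c else 0)" if "finite A" for A :: "'e set"
    using that by induction (auto simp: prod_eq_iff)
  ultimately show ?thesis using finite_subset[OF assms(2,1)] by (simp add: odd_vertices_def del: sum_constant)
qed

lemma boundary_add:
  "boundary G (\<lambda>e. f e + g e) v = boundary G f v + boundary G g v"
  unfolding boundary_def sum.distrib[symmetric] by (rule sum.cong) auto

lemma boundary_hom:
  fixes G :: "('v, 'e) multigraph"
  assumes "\<And>x y. \<sigma> (x + y) = \<sigma> x + \<sigma> y" and "\<sigma> 0 = 0"
  shows "boundary G (\<lambda>e. \<sigma> (f e)) v = \<sigma> (boundary G f v)"
proof -
  have "(\<Sum>e \<in> A. \<sigma> (g e)) = \<sigma> (sum g A)" for g and A :: "'e set"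
    by (induction A rule: infinite_finite_induct) (auto simp: assms)
  moreover have "(if b then \<sigma> x else 0) = \<sigma> (if b then x else 0)" for b x
    by (simp add: assms(2))
  ultimately show ?thesis by (simp add: boundary_def)
qed

lemma boundary_subgraph:
  assumes "is_subgraph H G" and "finite (edges G)" and "\<forall>e. e \<notin> edges H \<longrightarrow> f e = 0"
  shows "boundary G f v = boundary H f v"
  unfolding boundary_def
  using assms by (intro sum.mono_neutral_cong_right) (auto simp: is_subgraph_def)

section \<open>Colours and their automorphisms\<close>

type_synonym colour = "bit \<times> bit"

lemma colour_add_self [simp]: "(c::colour) + c = 0"
  by (simp add: prod_eq_iff)

lemma colour_add_eq_0_iff: "(c::colour) + d = 0 \<longleftrightarrow> c = d"
  by (metis colour_add_self add.assoc add.left_neutral add.right_neutral)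

text \<open>Together with the existential version, this turns statements about colours into finite
  checks.\<close>

lemma all_colours: "(\<forall>c::colour. P c) \<longleftrightarrow> P (0, 0) \<and> P (0, 1) \<and> P (1, 0) \<and> P (1, 1)"
  by (metis bit.exhaust surj_pair)

lemma ex_colours: "(\<exists>c::colour. P c) \<longleftrightarrow> P (0, 0) \<or> P (0, 1) \<or> P (1, 0) \<or> P (1, 1)"
  by (metis bit.exhaust surj_pair)

text \<open>On this finite group a trivial kernel makes an additive map bijective.\<close>

definition colour_auto :: "(colour \<Rightarrow> colour) \<Rightarrow> bool" where
  "colour_auto \<sigma> \<longleftrightarrow> (\<forall>c d. \<sigma> (c + d) = \<sigma> c + \<sigma> d) \<and> (\<forall>c. \<sigma> c = 0 \<longleftrightarrow> c = 0)"

text \<open>The linear map over the field with two elements taking \<open>(1, 0)\<close> to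
  \<open>a\<close> and \<open>(0, 1)\<close> to \<open>b\<close>.\<close>

definition linear_colour_map :: "colour \<Rightarrow> colour \<Rightarrow> colour \<Rightarrow> colour" where
  "linear_colour_map a b c = (if fst c = 0 then 0 else a) + (if snd c = 0 then 0 else b)"

lemma colour_auto_linear_colour_map:
  assumes "a \<noteq> 0" and "b \<noteq> 0" and "a \<noteq> b"
  shows "colour_auto (linear_colour_map a b)"
proof -
  have "\<forall>a b. a \<noteq> 0 \<longrightarrow> b \<noteq> 0 \<longrightarrow> a \<noteq> b \<longrightarrow> colour_auto (linear_colour_map a b)"
    unfolding all_colours colour_auto_def linear_colour_map_def by (simp add: zero_prod_def)
  then show ?thesis using assms by blast
qed

text \<open>Two distinct nonzero colours form a basis; the map is composed through the standard
  basis.\<close>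

lemma colour_auto_two_transitive:
  assumes "c \<noteq> 0" and "c' \<noteq> 0" and "c \<noteq> c'" and "d \<noteq> 0" and "d' \<noteq> 0" and "d \<noteq> d'"
  obtains \<sigma> where "colour_auto \<sigma>" and "\<sigma> c = d" and "\<sigma> c' = d'"
proof -
  have "\<forall>c c'. c \<noteq> 0 \<longrightarrow> c' \<noteq> 0 \<longrightarrow> c \<noteq> c' \<longrightarrow>
      (\<exists>\<tau>. colour_auto \<tau> \<and> \<tau> c = (1, 0) \<and> \<tau> c' = (0, 1))"
  proof (intro allI impI)
    fix c c' :: colour
    assume c: "c \<noteq> 0" "c' \<noteq> 0" "c \<noteq> c'"
    have "\<forall>c c'. c \<noteq> 0 \<longrightarrow> c' \<noteq> 0 \<longrightarrow> c \<noteq> c' \<longrightarrow> (\<exists>a b. a \<noteq> 0 \<and> b \<noteq> 0 \<and> a \<noteq> b \<and>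
        linear_colour_map a b c = (1, 0) \<and> linear_colour_map a b c' = (0, 1))"
      unfolding all_colours ex_colours linear_colour_map_def by (simp add: zero_prod_def)
    then show "\<exists>\<tau>. colour_auto \<tau> \<and> \<tau> c = (1, 0) \<and> \<tau> c' = (0, 1)"
      using c colour_auto_linear_colour_map by meson
  qed
  then obtain \<tau> where \<tau>: "colour_auto \<tau>" "\<tau> c = (1, 0)" "\<tau> c' = (0, 1)"
    using assms by blast
  have "colour_auto (linear_colour_map d d' \<circ> \<tau>)"
    using \<tau>(1) colour_auto_linear_colour_map[OF assms(4-6)]
    by (simp add: colour_auto_def del: split_paired_All)
  then show ?thesis using that \<tau>(2,3) by (simp add: linear_colour_map_def)
qed

lemma ex_third_colour: "\<exists>d::colour. d \<noteq> 0 \<and> d \<noteq> a \<and> d \<noteq> b"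
proof -
  have "\<forall>a b. \<exists>d::colour. d \<noteq> 0 \<and> d \<noteq> a \<and> d \<noteq> b"
    unfolding all_colours ex_colours by (simp add: zero_prod_def)
  then show ?thesis by blast
qed

lemma colour_auto_transitive:
  assumes "c \<noteq> 0" and "d \<noteq> 0"
  obtains \<sigma> where "colour_auto \<sigma>" and "\<sigma> c = d"
proof -
  obtain c' d' :: colour where "c' \<noteq> 0" "c \<noteq> c'" "d' \<noteq> 0" "d \<noteq> d'"
    using ex_third_colour by metis
  then show ?thesis using colour_auto_two_transitive[of c c' d d'] assms that by metis
qed

lemma colours_exhaust:
  fixes a b c :: colour
  assumes "a \<noteq> 0" "b \<noteq> 0" "a \<noteq> b" "c \<noteq> 0"
  shows "c = a \<or> c = b \<or> c = a + b"
proof -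
  have "\<forall>a b c::colour. a \<noteq> 0 \<longrightarrow> b \<noteq> 0 \<longrightarrow> a \<noteq> b \<longrightarrow> c \<noteq> 0 \<longrightarrow> c = a \<or> c = b \<or> c = a + b"
    unfolding all_colours by (simp add: zero_prod_def)
  then show ?thesis using assms by blast
qed

text \<open>The cases follow the equalities among the \<open>q\<close>. If all are equal, then
  \<open>p1 = p2\<close> and their common image has at most two values to avoid; if all are
  distinct, then \<open>p1 \<noteq> p2\<close> and a suitable permutation of the nonzero colours
  exists.\<close>

lemma colour_auto_avoiding_compatible:
  assumes "p1 \<noteq> 0" "p2 \<noteq> 0" "p3 \<noteq> 0" "q1 \<noteq> 0" "q2 \<noteq> 0" "q3 \<noteq> 0"
    and "p1 = p2 \<longleftrightarrow> q1 = q2"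
  shows "\<exists>\<sigma>. colour_auto \<sigma> \<and> \<sigma> q1 \<noteq> p1 \<and> \<sigma> q2 \<noteq> p2 \<and> \<sigma> q3 \<noteq> p3"
proof -
  \<comment> \<open>For exactly two equal \<open>q\<close>: their common value \<open>c\<close> has
    two forbidden images, the third value \<open>c'\<close> has one.\<close>
  have avoid: "\<exists>\<sigma>. colour_auto \<sigma> \<and> \<sigma> c \<noteq> a \<and> \<sigma> c \<noteq> b \<and> \<sigma> c' \<noteq> b'"
    if "c \<noteq> 0" "c' \<noteq> 0" "c \<noteq> c'" for a b b' c c' :: colour
  proof -
    obtain d where d: "d \<noteq> 0" "d \<noteq> a" "d \<noteq> b" using ex_third_colour by blast
    obtain d' where d': "d' \<noteq> 0" "d' \<noteq> d" "d' \<noteq> b'" using ex_third_colour by blast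
    show ?thesis
      using colour_auto_two_transitive[OF that d(1) d'(1)] d d' by metis
  qed
  consider "q1 = q2" "q3 = q1" | "q1 = q2" "q3 \<noteq> q1" | "q1 \<noteq> q2" "q3 = q1"
    | "q1 \<noteq> q2" "q3 = q2" | "q1 \<noteq> q2" "q3 = q1 + q2"
    using colours_exhaust assms(4-6) by blast
  then show ?thesis
  proof cases
    case 1
    obtain d where "d \<noteq> 0" "d \<noteq> p1" "d \<noteq> p3" using ex_third_colour by blast
    then show ?thesis using 1 assms(7) colour_auto_transitive[OF assms(4)] by metis
  next
    case 2
    then show ?thesis using avoid[of q1 q3] assms by metis
  next
    case 3
    then show ?thesis using avoid[of q1 q2] assms by metis
  next
    case 4
    then show ?thesis using avoid[of q2 q1] assms by metis
  next
    case 5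
    have "\<forall>p1 p2 p3::colour. p1 \<noteq> 0 \<longrightarrow> p2 \<noteq> 0 \<longrightarrow> p3 \<noteq> 0 \<longrightarrow> p1 \<noteq> p2 \<longrightarrow>
        (\<exists>d d'. d \<noteq> 0 \<and> d' \<noteq> 0 \<and> d \<noteq> d' \<and> d \<noteq> p1 \<and> d' \<noteq> p2 \<and> d + d' \<noteq> p3)"
      unfolding all_colours ex_colours by (simp add: zero_prod_def)
    then obtain d d' where d: "d \<noteq> 0" "d' \<noteq> 0" "d \<noteq> d'" "d \<noteq> p1" "d' \<noteq> p2" "d + d' \<noteq> p3"
      using assms(1-3,7) 5 by metis
    obtain \<sigma> where "colour_auto \<sigma>" "\<sigma> q1 = d" "\<sigma> q2 = d'"
      using colour_auto_two_transitive[OF assms(4,5) 5(1) d(1-3)] .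
    moreover from this have "\<sigma> q3 = d + d'"
      using 5(2) by (simp add: colour_auto_def del: split_paired_All)
    ultimately show ?thesis using d(4-6) by (intro exI[of _ \<sigma>]) simp
  qed
qed

text \<open>Among three pairs of indices 0, 1 or 3 can be equalities. If the \<open>p\<close> and
  the \<open>q\<close> disagreed on every pair, these counts would be 0 and 3, which is an excluded
  pattern; so they agree on some pair.\<close>

lemma colour_auto_avoiding:
  assumes "p1 \<noteq> 0" "p2 \<noteq> 0" "p3 \<noteq> 0" "q1 \<noteq> 0" "q2 \<noteq> 0" "q3 \<noteq> 0"
    and "\<not> (distinct [p1, p2, p3] \<and> q1 = q2 \<and> q2 = q3)"
    and "\<not> (distinct [q1, q2, q3] \<and> p1 = p2 \<and> p2 = p3)"
  shows "\<exists>\<sigma>. colour_auto \<sigma> \<and> \<sigma> q1 \<noteq> p1 \<and> \<sigma> q2 \<noteq> p2 \<and> \<sigma> q3 \<noteq> p3"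
proof -
  consider "p1 = p2 \<longleftrightarrow> q1 = q2" | "p1 = p3 \<longleftrightarrow> q1 = q3" | "p2 = p3 \<longleftrightarrow> q2 = q3"
    using assms(7,8) by auto
  then show ?thesis
    using colour_auto_avoiding_compatible[of p1 p2 p3 q1 q2 q3]
      colour_auto_avoiding_compatible[of p1 p3 p2 q1 q3 q2]
      colour_auto_avoiding_compatible[of p2 p3 p1 q2 q3 q1] assms(1-6)
    by cases blast+
qed

section \<open>Colour flows and integer flows\<close>

text \<open>The value zero is permitted, since modified flows may vanish on common edges.\<close>

definition colour_flow :: "('v, 'e) multigraph \<Rightarrow> ('e \<Rightarrow> colour) \<Rightarrow> bool" where
  "colour_flow G f \<longleftrightarrow> (\<forall>v. boundary G f v = 0)"

lemma colour_flow_add: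
  assumes "colour_flow G f" and "colour_flow G g"
  shows "colour_flow G (\<lambda>e. f e + g e)"
  using assms by (simp add: colour_flow_def boundary_add)

lemma colour_flow_indicator:
  assumes "finite (edges G)" and "J \<subseteq> edges G" and "odd_vertices G J = {}"
  shows "colour_flow G (\<lambda>e. if e \<in> J then c else 0)"
  using assms by (simp add: colour_flow_def boundary_indicator)

lemma colour_flow_auto:
  assumes "colour_auto \<sigma>" and "colour_flow G f"
  shows "colour_flow G (\<lambda>e. \<sigma> (f e))"
proof -
  have "boundary G (\<lambda>e. \<sigma> (f e)) v = \<sigma> (boundary G f v)" for v
    using assms(1) unfolding colour_auto_def by (intro boundary_hom) blast+
  then show ?thesis using assms by (simp add: colour_flow_def colour_auto_def del: split_paired_All)
qed

text \<open>Applying \<open>\<kappa>\<close> gives a flow with values in \<open>bit\<close>, which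
  is the indicator of its support.\<close>

lemma odd_vertices_functional_support:
  fixes \<kappa> :: "colour \<Rightarrow> bit"
  assumes "finite (edges G)" and "colour_flow G f"
    and "\<And>x y. \<kappa> (x + y) = \<kappa> x + \<kappa> y" and "\<kappa> 0 = 0"
  shows "odd_vertices G {e \<in> edges G. \<kappa> (f e) \<noteq> 0} = {}"
proof -
  have "even (card {e \<in> {e \<in> edges G. \<kappa> (f e) \<noteq> 0}. v \<in> ends G e})" for v
  proof -
    have "boundary G (\<lambda>e. \<kappa> (f e)) v = 0"
      using assms(2-4) by (simp add: boundary_hom colour_flow_def)
    then have "even (\<Sum>e \<in> edges G. if v \<in> ends G e then \<kappa> (f e) else 0)"
      by (simp add: boundary_def)
    moreover have "{e \<in> edges G. odd (if v \<in> ends G e then \<kappa> (f e) else 0)}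
        = {e \<in> {e \<in> edges G. \<kappa> (f e) \<noteq> 0}. v \<in> ends G e}"
      by (auto split: if_splits)
    ultimately show ?thesis using assms(1) by (simp only: even_sum_iff)
  qed
  then show ?thesis by (auto simp: odd_vertices_def)
qed

text \<open>The functional used is the determinant with \<open>c\<close>, whose kernel is \<open>{0, c}\<close>.\<close>

lemma odd_vertices_kempe:
  assumes "finite (edges G)" and "colour_flow G f" and "c \<noteq> 0"
  shows "odd_vertices G {e \<in> edges G. f e \<notin> {0, c}} = {}"
proof -
  let ?\<kappa> = "\<lambda>x::colour. fst c * snd x + snd c * fst x"
  have "\<forall>c x::colour. c \<noteq> 0 \<longrightarrow> (fst c * snd x + snd c * fst x \<noteq> 0) = (x \<notin> {0, c})"
    unfolding all_colours by (simp add: zero_prod_def)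
  then have "{e \<in> edges G. f e \<notin> {0, c}} = {e \<in> edges G. ?\<kappa> (f e) \<noteq> 0}"
    using assms(3) by blast
  moreover have "?\<kappa> (x + y) = ?\<kappa> x + ?\<kappa> y" for x y
    by (simp only: fst_add snd_add distrib_left ac_simps)
  ultimately show ?thesis
    using odd_vertices_functional_support[OF assms(1,2), of ?\<kappa>] by simp
qed

section \<open>Passing between integer flows and colour flows\<close>

lemma orientation_ends:
  assumes "finite_loopless_multigraph G" and "is_orientation D G"
  shows "\<forall>e \<in> edges G. ends G e = {tail D e, head D e} \<and> tail D e \<noteq> head D e"
proof
  fix e assume "e \<in> edges G"
  then have "ends G e = {tail D e, head D e}" "card (ends G e) = 2"
    using assms by (auto simp: finite_loopless_multigraph_def is_orientation_def)
  then show "ends G e = {tail D e, head D e} \<and> tail D e \<noteq> head D e" by auto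
qed

lemma even_set_unit_flow:
  fixes t h :: "'e \<Rightarrow> 'v"
  assumes "finite E" and "\<forall>e \<in> E. ends G e = {t e, h e} \<and> t e \<noteq> h e"
    and "H \<subseteq> E" and "odd_vertices G H = {}"
  obtains \<psi> :: "'e \<Rightarrow> int" where "\<forall>e \<in> H. \<bar>\<psi> e\<bar> = 1" and "\<forall>e. e \<notin> H \<longrightarrow> \<psi> e = 0"
    and "\<And>v. (\<Sum>e \<in> E. \<psi> e * (of_bool (t e = v) - of_bool (h e = v))) = 0"
proof -
  \<comment> \<open>Used as both exceptional vertices in \<open>euler_signing\<close>,
    \<open>w\<close> cancels out, whichever it is.\<close>
  obtain w :: 'v where True by blast
  have "finite H" using assms(1,3) by (rule finite_subset[rotated])
  then obtain \<epsilon> :: "'e \<Rightarrow> int" where \<epsilon>: "\<forall>e \<in> H. \<bar>\<epsilon> e\<bar> = 1"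
      "\<And>v. (\<Sum>e \<in> H. \<epsilon> e * (of_bool (t e = v) - of_bool (h e = v))) = 0"
    using euler_signing[of H G t h w w] assms by auto
  have "(\<Sum>e \<in> E. (if e \<in> H then \<epsilon> e else 0) * (of_bool (t e = v) - of_bool (h e = v)))
      = (\<Sum>e \<in> H. \<epsilon> e * (of_bool (t e = v) - of_bool (h e = v)))" for v
    using assms(1,3) by (intro sum.mono_neutral_cong_right) auto
  then show ?thesis
    using that[of "\<lambda>e. if e \<in> H then \<epsilon> e else 0"] \<epsilon> by simp
qed

text \<open>The edges of odd value form an even set \<open>A\<close>. Adding a unit flow
  \<open>\<epsilon>\<close> on \<open>A\<close> makes all values even, and halving gives an integer
  flow \<open>\<psi>\<close>, whose odd edges form an even set \<open>B\<close>. Off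
  \<open>A\<close> the value of \<open>\<phi>\<close> is 2 or -2, so \<open>\<psi>\<close> is odd
  there and \<open>A\<close>, \<open>B\<close> cover all edges.\<close>

lemma colour_flow_of_4_flow:
  assumes G: "finite_loopless_multigraph G" and "admits_nowhere_zero_4_flow G"
  shows "\<exists>f. colour_flow G f \<and> (\<forall>e. f e \<noteq> 0 \<longleftrightarrow> e \<in> edges G)"
proof -
  obtain D and \<phi> :: "'b \<Rightarrow> int" where D: "is_orientation D G"
      and \<phi>: "\<forall>e \<in> edges G. 0 < \<bar>\<phi> e\<bar> \<and> \<bar>\<phi> e\<bar> < 4"
        "\<forall>v \<in> vertices G. (\<Sum>e \<in> out_arcs D v. \<phi> e) = (\<Sum>e \<in> in_arcs D v. \<phi> e)"
    using assms(2) unfolding admits_nowhere_zero_4_flow_def nowhere_zero_4_flow_def by blast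
  let ?inc = "\<lambda>v e. of_bool (tail D e = v) - of_bool (head D e = v) :: int"
  have fin: "finite (edges G)" using G by (simp add: finite_loopless_multigraph_def)
  note th = orientation_ends[OF G D]
  have net: "(\<Sum>e \<in> edges G. \<phi> e * ?inc v e) = 0" for v
  proof (cases "v \<in> vertices G")
    case True
    then show ?thesis using \<phi>(2) orientation_netflow[OF D fin, of \<phi> v] by simp
  next
    case False
    then have "\<forall>e \<in> edges G. v \<notin> ends G e"
      using G by (auto simp: finite_loopless_multigraph_def)
    then have "\<forall>e \<in> edges G. tail D e \<noteq> v \<and> head D e \<noteq> v" using th by auto
    then show ?thesis by (intro sum.neutral) auto
  qed
  define A where "A = {e \<in> edges G. odd (\<phi> e)}"
  have A: "odd_vertices G A = {}"
    using odd_netflow_iff[OF fin th, of \<phi>] net unfolding A_def by auto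
  have "A \<subseteq> edges G" by (auto simp: A_def)
  then obtain \<epsilon> :: "'b \<Rightarrow> int" where \<epsilon>: "\<forall>e \<in> A. \<bar>\<epsilon> e\<bar> = 1" "\<forall>e. e \<notin> A \<longrightarrow> \<epsilon> e = 0"
      "\<And>v. (\<Sum>e \<in> edges G. \<epsilon> e * ?inc v e) = 0"
    using even_set_unit_flow[OF fin th _ A] by blast
  define \<psi> where "\<psi> e = (\<phi> e + \<epsilon> e) div 2" for e
  define B where "B = {e \<in> edges G. odd (\<psi> e)}"
  have \<psi>: "2 * \<psi> e = \<phi> e + \<epsilon> e" if "e \<in> edges G" for e
  proof -
    have "odd (\<epsilon> e)" if "e \<in> A"
    proof -
      have "\<bar>\<epsilon> e\<bar> = 1" using \<epsilon>(1) that by blast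
      then have "\<epsilon> e = 1 \<or> \<epsilon> e = -1" by linarith
      then show ?thesis by auto
    qed
    then have "even (\<phi> e + \<epsilon> e)" using \<epsilon>(2) \<open>e \<in> edges G\<close> by (cases "e \<in> A") (auto simp: A_def)
    then show ?thesis by (simp add: \<psi>_def)
  qed
  have "2 * (\<Sum>e \<in> edges G. \<psi> e * ?inc v e) = 0" for v
  proof -
    have "2 * (\<Sum>e \<in> edges G. \<psi> e * ?inc v e) = (\<Sum>e \<in> edges G. (\<phi> e + \<epsilon> e) * ?inc v e)"
      unfolding sum_distrib_left using \<psi> by (intro sum.cong) (auto simp flip: mult.assoc)
    also have "\<dots> = 0" using net \<epsilon>(3) by (simp add: distrib_right sum.distrib)
    finally show ?thesis .
  qed
  then have B: "odd_vertices G B = {}"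
    using odd_netflow_iff[OF fin th, of \<psi>] unfolding B_def by auto
  define f :: "'b \<Rightarrow> colour" where
    "f e = (if e \<in> A then (1, 0) else 0) + (if e \<in> B then (0, 1) else 0)" for e
  have "colour_flow G f"
    unfolding f_def using A B fin
    by (intro colour_flow_add colour_flow_indicator) (auto simp: A_def B_def)
  moreover have "f e \<noteq> 0" if e: "e \<in> edges G" for e
  proof -
    have "e \<in> B" if "e \<notin> A"
    proof -
      have "even (\<phi> e)" "\<epsilon> e = 0" using that \<epsilon>(2) e by (auto simp: A_def)
      moreover have "0 < \<bar>\<phi> e\<bar>" "\<bar>\<phi> e\<bar> < 4" using \<phi>(1) e by auto
      ultimately have "\<psi> e = 1 \<or> \<psi> e = -1" using \<psi>[OF e] by presburger
      then show ?thesis using e by (auto simp: B_def)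
    qed
    then show ?thesis by (auto simp: f_def zero_prod_def)
  qed
  moreover have "f e = 0" if "e \<notin> edges G" for e
    using that by (auto simp: f_def A_def B_def)
  ultimately show ?thesis by blast
qed

lemma orientation_exists:
  assumes "finite_loopless_multigraph G"
  shows "\<exists>D. is_orientation D G"
proof -
  have "\<exists>p. ends G e = {fst p, snd p}" if e: "e \<in> edges G" for e
  proof -
    obtain a b where "ends G e = {a, b}"
      using assms e by (auto simp: finite_loopless_multigraph_def card_2_iff)
    then have "ends G e = {fst (a, b), snd (a, b)}" by simp
    then show ?thesis by blast
  qed
  then obtain p where "\<forall>e \<in> edges G. ends G e = {fst (p e), snd (p e)}"
    by metis
  then have "is_orientation
      \<lparr>verts = vertices G, arcs = edges G, tail = \<lambda>e. fst (p e), head = \<lambda>e. snd (p e)\<rparr> G"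
    by (simp add: is_orientation_def)
  then show ?thesis by blast
qed

text \<open>The supports of the two coordinates are even sets covering all edges. With unit flows
  \<open>\<alpha>\<close>, \<open>\<beta>\<close> on them, \<open>2 * \<alpha> + \<beta>\<close> is
  nonzero and at most 3 in absolute value.\<close>

lemma admits_4_flow_of_colour_flow:
  assumes G: "finite_loopless_multigraph G" and f: "colour_flow G f" "\<forall>e \<in> edges G. f e \<noteq> 0"
  shows "admits_nowhere_zero_4_flow G"
proof -
  have fin: "finite (edges G)" using G by (simp add: finite_loopless_multigraph_def)
  obtain D where D: "is_orientation D G" using orientation_exists[OF G] by blast
  let ?inc = "\<lambda>v e. of_bool (tail D e = v) - of_bool (head D e = v) :: int"
  note th = orientation_ends[OF G D]
  define A where "A = {e \<in> edges G. fst (f e) \<noteq> 0}"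
  define B where "B = {e \<in> edges G. snd (f e) \<noteq> 0}"
  have AB: "A \<subseteq> edges G" "B \<subseteq> edges G" by (auto simp: A_def B_def)
  have A: "odd_vertices G A = {}" and B: "odd_vertices G B = {}"
    unfolding A_def B_def
    using odd_vertices_functional_support[OF fin f(1), of fst]
      odd_vertices_functional_support[OF fin f(1), of snd] by simp_all
  obtain \<alpha> :: "'b \<Rightarrow> int" where \<alpha>: "\<forall>e \<in> A. \<bar>\<alpha> e\<bar> = 1" "\<forall>e. e \<notin> A \<longrightarrow> \<alpha> e = 0"
      "\<And>v. (\<Sum>e \<in> edges G. \<alpha> e * ?inc v e) = 0"
    using even_set_unit_flow[OF fin th AB(1) A] by blast
  obtain \<beta> :: "'b \<Rightarrow> int" where \<beta>: "\<forall>e \<in> B. \<bar>\<beta> e\<bar> = 1" "\<forall>e. e \<notin> B \<longrightarrow> \<beta> e = 0"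
      "\<And>v. (\<Sum>e \<in> edges G. \<beta> e * ?inc v e) = 0"
    using even_set_unit_flow[OF fin th AB(2) B] by blast
  let ?\<phi> = "\<lambda>e. 2 * \<alpha> e + \<beta> e"
  have "(\<Sum>e \<in> edges G. ?\<phi> e * ?inc v e) = 0" for v
    using \<alpha>(3)[of v] \<beta>(3)[of v]
    by (simp add: distrib_right sum.distrib mult.assoc flip: sum_distrib_left)
  then have "(\<Sum>e \<in> out_arcs D v. ?\<phi> e) = (\<Sum>e \<in> in_arcs D v. ?\<phi> e)" for v
    using orientation_netflow[OF D fin, of ?\<phi> v] by simp
  moreover have "0 < \<bar>?\<phi> e\<bar> \<and> \<bar>?\<phi> e\<bar> < 4" if "e \<in> edges G" for e
  proof -
    have "e \<in> A \<or> e \<in> B" using f(2) that by (auto simp: A_def B_def prod_eq_iff)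
    moreover have "\<bar>\<alpha> e\<bar> = 1 \<or> \<alpha> e = 0 \<and> e \<notin> A" "\<bar>\<beta> e\<bar> = 1 \<or> \<beta> e = 0 \<and> e \<notin> B"
      using \<alpha>(1,2) \<beta>(1,2) by blast+
    ultimately show ?thesis by (auto simp: abs_if split: if_splits)
  qed
  ultimately have "nowhere_zero_4_flow G D ?\<phi>" using D by (simp add: nowhere_zero_4_flow_def)
  then show ?thesis by (auto simp: admits_nowhere_zero_4_flow_def)
qed

section \<open>Gluing flows\<close>

text \<open>The sum vanishes only where its terms agree. Nonzero values are demanded off the overlap
  only, so that modified flows qualify.\<close>

lemma colour_flow_combine:
  assumes "colour_flow G f1" and "colour_flow G f2" and \<sigma>: "colour_auto \<sigma>"
    and "\<forall>e. e \<notin> E1 \<longrightarrow> f1 e = 0" and "\<forall>e. e \<notin> E2 \<longrightarrow> f2 e = 0"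
    and "\<forall>e \<in> E1 - E2. f1 e \<noteq> 0" and "\<forall>e \<in> E2 - E1. f2 e \<noteq> 0"
    and "\<forall>e \<in> E1 \<inter> E2. \<sigma> (f2 e) \<noteq> f1 e"
  shows "\<exists>f. colour_flow G f \<and> (\<forall>e \<in> E1 \<union> E2. f e \<noteq> 0)"
proof (intro exI conjI ballI)
  show "colour_flow G (\<lambda>e. f1 e + \<sigma> (f2 e))"
    by (rule colour_flow_add[OF assms(1) colour_flow_auto[OF \<sigma> assms(2)]])
  fix e assume "e \<in> E1 \<union> E2"
  moreover have "\<sigma> c = 0 \<longleftrightarrow> c = 0" for c using \<sigma> unfolding colour_auto_def by blast
  ultimately have "f1 e \<noteq> \<sigma> (f2 e)" using assms(4-8) by (metis DiffI IntI UnE)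
  then show "f1 e + \<sigma> (f2 e) \<noteq> 0" by (simp add: colour_add_eq_0_iff)
qed

lemma recolour:
  assumes "finite (edges G)" and "colour_flow G f" and "K \<subseteq> edges G" and "odd_vertices G K = {}"
  shows "colour_flow G (\<lambda>e. f e + (if e \<in> K then d else 0))"
  using assms by (intro colour_flow_add colour_flow_indicator)

text \<open>Otherwise a walk in \<open>F\<close> starting at an end of \<open>e\<close> could never
  leave the vertices covered by \<open>S\<close>.\<close>

lemma connected_edges_meet:
  assumes "connected_multigraph (edge_induced_subgraph G F)"
    and "S \<subseteq> F" and "e \<in> S" "f \<in> F - S" and "ends G e \<noteq> {}" "ends G f \<noteq> {}"
  shows "\<exists>e' \<in> S. \<exists>f' \<in> F - S. ends G e' \<inter> ends G f' \<noteq> {}"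
proof (rule ccontr)
  assume contra: "\<not> ?thesis"
  obtain u w where u: "u \<in> ends G e" and w: "w \<in> ends G f" using assms(5,6) by blast
  let ?G = "edge_induced_subgraph G F"
  have "(u, w) \<in> (adjacency ?G)\<^sup>*"
    using assms(1-4) u w unfolding connected_multigraph_def edge_induced_subgraph_def by auto
  then have "\<exists>e' \<in> S. w \<in> ends G e'"
  proof induction
    case base
    then show ?case using u assms(3) by blast
  next
    case (step x y)
    then obtain g where g: "g \<in> F" "ends G g = {x, y}"
      by (auto simp: adjacency_def edge_induced_subgraph_def)
    then have "g \<in> S" using step.IH contra by blast
    then show ?case using g(2) by blast
  qed
  then show False using contra w assms(4) by blast
qed

text \<open>Some \<open>f\<close> meets \<open>x\<close>, and the last edge \<open>g\<close> meets
  \<open>x\<close> or \<open>f\<close>; the one it meets becomes the middle edge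
  \<open>e2\<close>.\<close>

lemma connected_three_edges:
  assumes "connected_multigraph (edge_induced_subgraph G F)" and "card F = 3"
    and ne: "\<forall>e \<in> F. ends G e \<noteq> {}"
  obtains e1 e2 e3 where "F = {e1, e2, e3}" and "e1 \<noteq> e2" "e1 \<noteq> e3" "e2 \<noteq> e3"
    and "ends G e1 \<inter> ends G e2 \<noteq> {}" and "ends G e2 \<inter> ends G e3 \<noteq> {}"
proof -
  obtain x y z where F: "F = {x, y, z}" and d: "x \<noteq> y" "x \<noteq> z" "y \<noteq> z"
    using assms(2) by (auto simp: card_3_iff)
  have "\<exists>f \<in> F - {x}. ends G x \<inter> ends G f \<noteq> {}"
    using connected_edges_meet[OF assms(1), of "{x}" x y] F d ne by auto
  then obtain f where f: "f \<in> {y, z}" "ends G x \<inter> ends G f \<noteq> {}" using F by auto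
  define g where "g = (if f = y then z else y)"
  have F': "F = {x, f, g}" "f \<noteq> x" "g \<noteq> x" "f \<noteq> g" using F d f(1) by (auto simp: g_def)
  have "\<exists>e \<in> {x, f}. ends G e \<inter> ends G g \<noteq> {}"
    using connected_edges_meet[OF assms(1), of "{x, f}" x g] F' ne by auto
  then show ?thesis
    using that[of x f g] that[of f x g] F' f(2) by (auto simp: Int_commute insert_commute)
qed

section \<open>The exceptional overlap: cycles, stars and paths\<close>

lemma odd_vertices_parallel:
  assumes "e \<noteq> f" and "ends G e = ends G f"
  shows "odd_vertices G {e, f} = {}"
proof -
  have "v \<notin> odd_vertices G {e, f}" for v
    using assms by (simp add: odd_vertices_insert)
  then show ?thesis by blast
qed

text \<open>With three common edges \<open>f1\<close> takes every nonzero colour on them, so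
  \<open>\<sigma> c\<close> collides with some \<open>f1 e\<close> for every automorphism
  \<open>\<sigma>\<close>.\<close>

locale constant_overlap =
  fixes G :: "('v, 'e) multigraph" and E1 E2 :: "'e set" and f1 f2 :: "'e \<Rightarrow> colour" and c :: colour
  assumes G: "finite_loopless_multigraph G" and E: "edges G = E1 \<union> E2"
    and flow1: "colour_flow G f1" and supp1: "f1 e \<noteq> 0 \<longleftrightarrow> e \<in> E1"
    and flow2: "colour_flow G f2" and supp2: "f2 e \<noteq> 0 \<longleftrightarrow> e \<in> E2"
    and inj: "inj_on f1 (E1 \<inter> E2)" and const: "e \<in> E1 \<inter> E2 \<Longrightarrow> f2 e = c" and c: "c \<noteq> 0"
begin

lemma fin: "finite (edges G)"
  using G by (simp add: finite_loopless_multigraph_def)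

lemma card_ends: "e \<in> edges G \<Longrightarrow> card (ends G e) = 2"
  using G by (simp add: finite_loopless_multigraph_def)

text \<open>Adding \<open>c\<close> along \<open>C\<close> makes \<open>f2\<close> vanish on
  \<open>C\<close>, where \<open>f1\<close> does not. At most \<open>e3\<close> remains, and
  \<open>m\<close> is chosen to avoid its colour.\<close>

lemma flow_if_even_subset:
  assumes C: "C \<subseteq> E1 \<inter> E2" "odd_vertices G C = {}" and e3: "E1 \<inter> E2 - C \<subseteq> {e3}"
  shows "\<exists>f. colour_flow G f \<and> (\<forall>e \<in> edges G. f e \<noteq> 0)"
proof -
  obtain m where m: "m \<noteq> 0" "m \<noteq> f1 e3" using ex_third_colour by blast
  obtain \<sigma> where \<sigma>: "colour_auto \<sigma>" "\<sigma> c = m" using colour_auto_transitive[OF c m(1)] .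
  have \<sigma>0: "\<sigma> 0 = 0" using \<sigma>(1) by (simp add: colour_auto_def del: split_paired_All)
  let ?f2 = "\<lambda>e. f2 e + (if e \<in> C then c else 0)"
  have flow: "colour_flow G ?f2" using recolour[OF fin flow2 _ C(2)] C(1) E by blast
  have val: "?f2 e = (if e \<in> C then 0 else c)" if "e \<in> E1 \<inter> E2" for e
    using const[OF that] by simp
  have "\<forall>e \<in> E1 \<inter> E2. \<sigma> (?f2 e) \<noteq> f1 e"
  proof
    fix e assume e: "e \<in> E1 \<inter> E2"
    show "\<sigma> (?f2 e) \<noteq> f1 e"
    proof (cases "e \<in> C")
      case True
      then show ?thesis using val[OF e] \<sigma>0 supp1[of e] e by simp
    next
      case False
      then have "e = e3" using e e3 by blast
      then show ?thesis using val[OF e] False \<sigma>(2) m(2) by simp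
    qed
  qed
  moreover have "\<forall>e. e \<notin> E2 \<longrightarrow> ?f2 e = 0" "\<forall>e \<in> E2 - E1. ?f2 e \<noteq> 0"
    using C(1) supp2 by auto
  ultimately show ?thesis
    unfolding E using supp1 by (intro colour_flow_combine[OF flow1 flow \<sigma>(1)]) auto
qed

text \<open>Adding \<open>d\<close> along \<open>K\<close> changes \<open>f2\<close> on a single
  common edge \<open>k\<close>. Then \<open>f2\<close> takes exactly two values, both nonzero, on
  the star, and \<open>colour_auto_avoiding\<close> applies.\<close>

lemma flow_if_star:
  assumes F: "E1 \<inter> E2 = {e1, e2, e3}" and e: "e1 \<noteq> e2" "e1 \<noteq> e3" "e2 \<noteq> e3"
    and ends: "ends G e1 = {z, v1}" "ends G e2 = {z, v2}" "ends G e3 = {z, v3}"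
    and v: "distinct [z, v1, v2, v3]"
  shows "\<exists>f. colour_flow G f \<and> (\<forall>e \<in> edges G. f e \<noteq> 0)"
proof -
  obtain d where d: "d \<noteq> 0" "d \<noteq> c" using ex_third_colour by blast
  define H where "H = {e \<in> edges G. f2 e \<notin> {0, d}}"
  have H0: "odd_vertices G H = {}" unfolding H_def using odd_vertices_kempe[OF fin flow2 d(1)] .
  have finH: "finite H" using fin by (simp add: H_def)
  have FH: "E1 \<inter> E2 \<subseteq> H" using const d c E by (auto simp: H_def)
  have HE2: "H \<subseteq> E2" using supp2 by (auto simp: H_def)
  let ?H = "H - {e1} - {e2} - {e3}"
  \<comment> \<open>The three removals flip the parity of the centre \<open>z\<close> three times
    and of each leaf once.\<close>
  have "v \<in> odd_vertices G ?H \<longleftrightarrow> v \<in> {z, v1, v2, v3}" for v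
    using FH F e finH v H0 by (auto simp: odd_vertices_remove ends)
  then have oddH: "odd_vertices G ?H = {z, v1, v2, v3}" by blast
  have "\<forall>e \<in> ?H. card (ends G e) = 2" using card_ends by (auto simp: H_def)
  then obtain J y where J: "J \<subseteq> ?H" "y \<in> {v1, v2, v3}" "odd_vertices G J = {z, y}"
    using odd_vertices_trail[of ?H G z] finH oddH by auto
  obtain k where k: "k \<in> E1 \<inter> E2" "ends G k = {z, y}" using J(2) ends F by auto
  define K where "K = insert k J"
  have "k \<notin> J" using J(1) k(1) F by auto
  moreover have "finite J" using J(1) finH by (meson finite_Diff finite_subset)
  ultimately have "v \<notin> odd_vertices G K" for v
    unfolding K_def using J(3) k(2) by (simp add: odd_vertices_insert)
  then have K0: "odd_vertices G K = {}" by blast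
  have KH: "K \<subseteq> H" using J(1) k(1) FH by (auto simp: K_def)
  then have KE: "K \<subseteq> edges G" by (auto simp: H_def)
  let ?f2 = "\<lambda>e. f2 e + (if e \<in> K then d else 0)"
  have flow: "colour_flow G ?f2" using recolour[OF fin flow2 KE K0] .
  have val: "?f2 e = (if e = k then c + d else c)" if "e \<in> E1 \<inter> E2" for e
  proof -
    have "e \<notin> J" using J(1) that F by blast
    then show ?thesis using const[OF that] by (simp add: K_def)
  qed
  have cd: "c + d \<noteq> 0" "c + d \<noteq> c" using d by (auto simp: colour_add_eq_0_iff)
  have p: "f1 e1 \<noteq> f1 e2" "f1 e1 \<noteq> f1 e3" "f1 e2 \<noteq> f1 e3" "f1 e1 \<noteq> 0" "f1 e2 \<noteq> 0" "f1 e3 \<noteq> 0"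
    using inj e F supp1 by (auto simp: inj_on_def)
  have q: "?f2 e1 = (if e1 = k then c + d else c)" "?f2 e2 = (if e2 = k then c + d else c)"
      "?f2 e3 = (if e3 = k then c + d else c)"
    using val F by blast+
  have "\<exists>\<sigma>. colour_auto \<sigma> \<and> \<sigma> (?f2 e1) \<noteq> f1 e1 \<and> \<sigma> (?f2 e2) \<noteq> f1 e2 \<and> \<sigma> (?f2 e3) \<noteq> f1 e3"
    unfolding q using p cd c e k(1) F by (intro colour_auto_avoiding) auto
  then obtain \<sigma> where \<sigma>: "colour_auto \<sigma>" "\<forall>e \<in> E1 \<inter> E2. \<sigma> (?f2 e) \<noteq> f1 e"
    unfolding F by blast
  \<comment> \<open>On \<open>K\<close> the colour differs from \<open>d\<close>, so adding
    \<open>d\<close> creates no zero.\<close>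
  have "?f2 e \<noteq> 0" if "e \<in> E2 - E1" for e
    using KH supp2[of e] that by (auto simp: H_def colour_add_eq_0_iff)
  moreover have "?f2 e = 0" if "e \<notin> E2" for e using that KH HE2 supp2 by auto
  ultimately show ?thesis
    unfolding E using supp1 by (intro colour_flow_combine[OF flow1 flow \<sigma>(1) _ _ _ _ \<sigma>(2)]) auto
qed

text \<open>Adding \<open>d\<close> exchanges the colours of \<open>e1\<close> and \<open>e3\<close>
  and turns \<open>d\<close> into 0. The aim is that the new \<open>f1\<close> misses a nonzero
  colour \<open>m\<close> on the path; then \<open>c\<close> is sent to \<open>m\<close>.\<close>

lemma flow_if_path:
  assumes F: "E1 \<inter> E2 = {e1, e2, e3}" and e: "e1 \<noteq> e2" "e1 \<noteq> e3" "e2 \<noteq> e3"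
    and ends: "ends G e1 = {v0, v1}" "ends G e2 = {v1, v2}" "ends G e3 = {v2, v3}"
    and v: "distinct [v0, v1, v2, v3]"
  shows "\<exists>f. colour_flow G f \<and> (\<forall>e \<in> edges G. f e \<noteq> 0)"
proof -
  define d where "d = f1 e2"
  have p: "f1 e1 \<noteq> d" "f1 e1 \<noteq> f1 e3" "f1 e3 \<noteq> d" "f1 e1 \<noteq> 0" "d \<noteq> 0" "f1 e3 \<noteq> 0"
    using inj e F supp1 by (auto simp: inj_on_def d_def)
  define H where "H = {e \<in> edges G. f1 e \<notin> {0, d}}"
  have H0: "odd_vertices G H = {}" unfolding H_def using odd_vertices_kempe[OF fin flow1 p(5)] .
  have finH: "finite H" using fin by (simp add: H_def)
  have eH: "e1 \<in> H" "e2 \<notin> H" "e3 \<in> H" using p E F by (auto simp: H_def d_def)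
  have HE1: "H \<subseteq> E1" using supp1 by (auto simp: H_def)
  let ?H = "H - {e1} - {e3}"
  have "v \<in> odd_vertices G ?H \<longleftrightarrow> v \<in> {v0, v1, v2, v3}" for v
    using eH e finH v H0 by (auto simp: odd_vertices_remove ends)
  then have oddH: "odd_vertices G ?H = {v0, v1, v2, v3}" by blast
  have "\<forall>e \<in> ?H. card (ends G e) = 2" using card_ends by (auto simp: H_def)
  then obtain J y where J: "J \<subseteq> ?H" "y \<in> {v1, v2, v3}" "odd_vertices G J = {v0, y}"
    using odd_vertices_trail[of ?H G v0] finH oddH by auto
  have finJ: "finite J" using J(1) finH by (meson finite_Diff finite_subset)
  have eJ: "e1 \<notin> J" "e2 \<notin> J" "e3 \<notin> J" using J(1) eH by auto
  \<comment> \<open>\<open>J\<close> is closed along the path from \<open>y\<close> back to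
    \<open>v0\<close>: either by \<open>e1\<close> alone, or through \<open>e2\<close>.\<close>
  have "\<exists>K. K \<subseteq> J \<union> {e1, e2, e3} \<and> odd_vertices G K = {} \<and> (e2 \<in> K \<or> e1 \<in> K \<and> e3 \<notin> K)"
  proof -
    consider "y = v1" | "y = v2" | "y = v3" using J(2) by blast
    then show ?thesis
    proof cases
      case 1
      then have "v \<notin> odd_vertices G (insert e1 J)" for v
        using finJ eJ e v by (auto simp: odd_vertices_insert J(3) ends)
      then show ?thesis using eJ e by (intro exI[of _ "insert e1 J"]) auto
    next
      case 2
      then have "v \<notin> odd_vertices G (insert e1 (insert e2 J))" for v
        using finJ eJ e v by (auto simp: odd_vertices_insert J(3) ends)
      then show ?thesis by (intro exI[of _ "insert e1 (insert e2 J)"]) auto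
    next
      case 3
      then have "v \<notin> odd_vertices G (insert e1 (insert e2 (insert e3 J)))" for v
        using finJ eJ e v by (auto simp: odd_vertices_insert J(3) ends)
      then show ?thesis by (intro exI[of _ "insert e1 (insert e2 (insert e3 J))"]) auto
    qed
  qed
  then obtain K where K: "K \<subseteq> J \<union> {e1, e2, e3}" "odd_vertices G K = {}"
    and K12: "e2 \<in> K \<or> e1 \<in> K \<and> e3 \<notin> K" by blast
  have KE: "K \<subseteq> edges G" using K(1) J(1) F E by (auto simp: H_def)
  let ?f1 = "\<lambda>e. f1 e + (if e \<in> K then d else 0)"
  have flow: "colour_flow G ?f1" using recolour[OF fin flow1 KE K(2)] .
  \<comment> \<open>If \<open>e2\<close> is in \<open>K\<close>, it becomes 0 and nothing on the
    path has colour \<open>d\<close>. Otherwise \<open>e1\<close> takes the colour of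
    \<open>e3\<close>, which keeps it, and the old colour of \<open>e1\<close> is free.\<close>
  define m where "m = (if e2 \<in> K then d else f1 e1)"
  have "?f1 e1 \<noteq> m" "?f1 e2 \<noteq> m" "?f1 e3 \<noteq> m"
    using K12 p by (auto simp: m_def d_def[symmetric])
  then have m: "\<forall>e \<in> E1 \<inter> E2. ?f1 e \<noteq> m" unfolding F by blast
  have "m \<noteq> 0" using p by (simp add: m_def)
  then obtain \<sigma> where \<sigma>: "colour_auto \<sigma>" "\<sigma> c = m" by (rule colour_auto_transitive[OF c])
  have "\<forall>e \<in> E1 \<inter> E2. \<sigma> (f2 e) \<noteq> ?f1 e" using const \<sigma>(2) m by metis
  moreover have "?f1 e \<noteq> 0" if e: "e \<in> E1 - E2" for e
  proof (cases "e \<in> K")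
    case True
    then have "e \<in> H" using e K(1) F J(1) by blast
    then show ?thesis using True by (auto simp: H_def colour_add_eq_0_iff)
  next
    case False
    then show ?thesis using supp1[of e] e by simp
  qed
  moreover have "?f1 e = 0" if "e \<notin> E1" for e
    using that K(1) J(1) HE1 F supp1[of e] by auto
  ultimately show ?thesis
    unfolding E using supp2 by (intro colour_flow_combine[OF flow flow2 \<sigma>(1)]) auto
qed

text \<open>The middle edge \<open>e2\<close> joins \<open>p\<close> and \<open>q\<close>, with
  \<open>e1\<close> at \<open>p\<close>. If \<open>e3\<close> is at \<open>p\<close> too, there is a
  star or a parallel pair; if it is at \<open>q\<close>, there is a parallel pair, a triangle or a
  path.\<close>

lemma flow_if_connected:
  assumes conn: "connected_multigraph (edge_induced_subgraph G (E1 \<inter> E2))" and card: "card (E1 \<inter> E2) = 3"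
  shows "\<exists>f. colour_flow G f \<and> (\<forall>e \<in> edges G. f e \<noteq> 0)"
proof -
  have "\<forall>e \<in> E1 \<inter> E2. ends G e \<noteq> {}" using card_ends E by fastforce
  then obtain e1 e2 e3 where F: "E1 \<inter> E2 = {e1, e2, e3}" and e: "e1 \<noteq> e2" "e1 \<noteq> e3" "e2 \<noteq> e3"
    and meet: "ends G e1 \<inter> ends G e2 \<noteq> {}" "ends G e2 \<inter> ends G e3 \<noteq> {}"
    using connected_three_edges[OF conn card] by metis
  have two: "card (ends G e1) = 2" "card (ends G e2) = 2" "card (ends G e3) = 2"
    using card_ends F E by auto
  have digon: ?thesis if "{k, l, j} = {e1, e2, e3}" "k \<noteq> l" "ends G k = ends G l" for k l j
  proof (rule flow_if_even_subset)
    show "odd_vertices G {k, l} = {}" using that(2,3) by (rule odd_vertices_parallel)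
    show "{k, l} \<subseteq> E1 \<inter> E2" "E1 \<inter> E2 - {k, l} \<subseteq> {j}" unfolding F that(1)[symmetric] by blast+
  qed
  obtain p where p: "p \<in> ends G e1" "p \<in> ends G e2" using meet(1) by blast
  obtain q where q: "ends G e2 = {p, q}" "q \<noteq> p" using card_two_other[OF two(2) p(2)] .
  obtain a where a: "ends G e1 = {p, a}" "a \<noteq> p" using card_two_other[OF two(1) p(1)] .
  have "p \<in> ends G e3 \<or> q \<in> ends G e3" using meet(2) q by auto
  then show ?thesis
  proof
    assume "p \<in> ends G e3"
    then obtain b where b: "ends G e3 = {p, b}" "b \<noteq> p" using card_two_other[OF two(3)] by blast
    show ?thesis
    proof (cases "distinct [p, a, q, b]")
      case True
      then show ?thesis using flow_if_star[OF F e a(1) q(1) b(1)] by blast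
    next
      case False
      then consider "a = q" | "a = b" | "q = b" using a(2) b(2) q(2) by auto
      then show ?thesis
        using digon[of e1 e2 e3] digon[of e1 e3 e2] digon[of e2 e3 e1] e a b q
        by cases (auto simp: insert_commute)
    qed
  next
    assume "q \<in> ends G e3"
    then obtain b where b: "ends G e3 = {q, b}" "b \<noteq> q" using card_two_other[OF two(3)] by blast
    have a': "ends G e1 = {a, p}" using a(1) by auto
    consider "a = q" | "b = p" | "a = b" "a \<noteq> q" | "distinct [a, p, q, b]" using a(2) b(2) q(2) by auto
    then show ?thesis
    proof cases
      case 1
      then show ?thesis using digon[of e1 e2 e3] e a q by auto
    next
      case 2
      then show ?thesis using digon[of e2 e3 e1] e b q by (auto simp: insert_commute)
    next
      case 3
      \<comment> \<open>A triangle is an even set exhausting the overlap, so any edge can stand for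
        the leftover one.\<close>
      have "v \<notin> odd_vertices G {e1, e2, e3}" for v
        using e 3 a(2) b(2) q(2) by (auto simp: odd_vertices_insert a(1) b(1) q(1))
      then show ?thesis using flow_if_even_subset[of "{e1, e2, e3}" e1] F by blast
    next
      case 4
      then show ?thesis using flow_if_path[OF F e a' q(1) b(1)] by blast
    qed
  qed
qed

end

section \<open>Gluing in general and the return to integer flows\<close>

lemma colour_flow_union:
  assumes G: "finite_loopless_multigraph G" and E: "edges G = E1 \<union> E2"
    and f1: "colour_flow G f1" "\<And>e. f1 e \<noteq> 0 \<longleftrightarrow> e \<in> E1"
    and f2: "colour_flow G f2" "\<And>e. f2 e \<noteq> 0 \<longleftrightarrow> e \<in> E2"
    and card: "card (E1 \<inter> E2) \<le> 3"
    and conn: "connected_multigraph (edge_induced_subgraph G (E1 \<inter> E2))"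
  shows "\<exists>f. colour_flow G f \<and> (\<forall>e \<in> edges G. f e \<noteq> 0)"
proof -
  have fin: "finite (E1 \<inter> E2)" using G E by (simp add: finite_loopless_multigraph_def)
  have combine: ?thesis if "colour_auto \<sigma>" "\<forall>e \<in> E1 \<inter> E2. \<sigma> (f2 e) \<noteq> f1 e" for \<sigma>
    unfolding E using f1(2) f2(2) that(2) by (intro colour_flow_combine[OF f1(1) f2(1) that(1)]) auto
  show ?thesis
  proof (cases "E1 \<inter> E2 = {}")
    case True
    have "colour_auto (\<lambda>x. x)" by (simp add: colour_auto_def)
    then show ?thesis using True by (intro combine) auto
  next
    case False
    \<comment> \<open>Smaller overlaps are listed with repetitions, so the three names may
      coincide.\<close>
    obtain e1 e2 e3 where F: "E1 \<inter> E2 = {e1, e2, e3}"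
    proof -
      have "card (E1 \<inter> E2) \<noteq> 0" using False fin by simp
      then consider "card (E1 \<inter> E2) = 1" | "card (E1 \<inter> E2) = 2" | "card (E1 \<inter> E2) = 3"
        using card by linarith
      then show ?thesis
      proof cases
        case 1
        then obtain x where "E1 \<inter> E2 = {x}" by (auto simp: card_1_singleton_iff)
        then show ?thesis using that[of x x x] by simp
      next
        case 2
        then obtain x y where "E1 \<inter> E2 = {x, y}" by (auto simp: card_2_iff)
        then show ?thesis using that[of x y y] by simp
      next
        case 3
        then obtain x y z where "E1 \<inter> E2 = {x, y, z}" by (auto simp: card_3_iff)
        then show ?thesis using that[of x y z] by simp
      qed
    qed
    have nz: "f1 e1 \<noteq> 0" "f1 e2 \<noteq> 0" "f1 e3 \<noteq> 0" "f2 e1 \<noteq> 0" "f2 e2 \<noteq> 0" "f2 e3 \<noteq> 0"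
      using f1(2) f2(2) F by blast+
    consider "distinct [f1 e1, f1 e2, f1 e3]" "f2 e1 = f2 e2" "f2 e2 = f2 e3"
      | "distinct [f2 e1, f2 e2, f2 e3]" "f1 e1 = f1 e2" "f1 e2 = f1 e3"
      | \<sigma> where "colour_auto \<sigma>" "\<sigma> (f2 e1) \<noteq> f1 e1" "\<sigma> (f2 e2) \<noteq> f1 e2" "\<sigma> (f2 e3) \<noteq> f1 e3"
      using colour_auto_avoiding[OF nz] by blast
    then show ?thesis
    proof cases
      case 1
      \<comment> \<open>Three different colours force three different edges.\<close>
      then have "card (E1 \<inter> E2) = 3" unfolding F by (auto simp: card_insert_if)
      have const: "f2 e = f2 e1" if "e \<in> E1 \<inter> E2" for e using that 1 F by (metis insertE singletonD)
      have inj: "inj_on f1 (E1 \<inter> E2)" unfolding F using 1 by auto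
      interpret constant_overlap G E1 E2 f1 f2 "f2 e1"
        by unfold_locales (fact G E f1 f2 inj const nz(4))+
      show ?thesis using flow_if_connected conn \<open>card (E1 \<inter> E2) = 3\<close> by blast
    next
      case 2
      then have "card (E2 \<inter> E1) = 3" unfolding Int_commute[of E2] F by (auto simp: card_insert_if)
      have const: "f1 e = f1 e1" if "e \<in> E2 \<inter> E1" for e using that 2 F by (metis Int_commute insertE singletonD)
      have inj: "inj_on f2 (E2 \<inter> E1)" unfolding Int_commute[of E2] F using 2 by auto
      have E': "edges G = E2 \<union> E1" using E by (simp add: Un_commute)
      \<comment> \<open>The same situation with the two flows exchanged.\<close>
      interpret constant_overlap G E2 E1 f2 f1 "f1 e1"
        by unfold_locales (fact G E' f1 f2 inj const nz(1))+
      show ?thesis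
        using flow_if_connected conn \<open>card (E2 \<inter> E1) = 3\<close> by (simp add: Int_commute)
    next
      case 3
      then show ?thesis using F by (intro combine[of \<sigma>]) auto
    qed
  qed
qed

text \<open>The colour flow of \<open>H\<close> is zero off its edges, so its boundary is the same
  in \<open>G\<close>.\<close>

lemma subgraph_colour_flow:
  assumes "finite_loopless_multigraph G" and "is_subgraph H G" and "admits_nowhere_zero_4_flow H"
  obtains f where "colour_flow G f" and "\<And>e. f e \<noteq> 0 \<longleftrightarrow> e \<in> edges H"
proof -
  have "finite_loopless_multigraph H"
    using assms(1,2) unfolding finite_loopless_multigraph_def is_subgraph_def
    by (metis finite_subset subsetD)
  then obtain f where f: "colour_flow H f" "\<And>e. f e \<noteq> 0 \<longleftrightarrow> e \<in> edges H"
    using colour_flow_of_4_flow assms(3) by blast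
  have "boundary G f v = boundary H f v" for v
    using boundary_subgraph[OF assms(2)] assms(1) f(2) by (auto simp: finite_loopless_multigraph_def)
  then have "colour_flow G f" using f(1) by (simp add: colour_flow_def)
  then show ?thesis using f(2) by (rule that)
qed

theorem theorem4p2:
  fixes \<Gamma> \<Gamma>\<^sub>1 \<Gamma>\<^sub>2 :: "('v, 'e) multigraph"
  assumes "finite_loopless_multigraph \<Gamma>"
    and "is_subgraph \<Gamma>\<^sub>1 \<Gamma>" and "is_subgraph \<Gamma>\<^sub>2 \<Gamma>"
    and "is_union_of \<Gamma> \<Gamma>\<^sub>1 \<Gamma>\<^sub>2"
    and "card (edges \<Gamma>\<^sub>1 \<inter> edges \<Gamma>\<^sub>2) \<le> 3"
    and "connected_multigraph (edge_induced_subgraph \<Gamma> (edges \<Gamma>\<^sub>1 \<inter> edges \<Gamma>\<^sub>2))"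
    and "admits_nowhere_zero_4_flow \<Gamma>\<^sub>1"
    and "admits_nowhere_zero_4_flow \<Gamma>\<^sub>2"
  shows "admits_nowhere_zero_4_flow \<Gamma>"
proof -
  obtain f1 where f1: "colour_flow \<Gamma> f1" "\<And>e. f1 e \<noteq> 0 \<longleftrightarrow> e \<in> edges \<Gamma>\<^sub>1"
    using subgraph_colour_flow[OF assms(1,2,7)] by blast
  obtain f2 where f2: "colour_flow \<Gamma> f2" "\<And>e. f2 e \<noteq> 0 \<longleftrightarrow> e \<in> edges \<Gamma>\<^sub>2"
    using subgraph_colour_flow[OF assms(1,3,8)] by blast
  have "edges \<Gamma> = edges \<Gamma>\<^sub>1 \<union> edges \<Gamma>\<^sub>2" using assms(4) by (simp add: is_union_of_def)
  then have "\<exists>f. colour_flow \<Gamma> f \<and> (\<forall>e \<in> edges \<Gamma>. f e \<noteq> 0)"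
    using colour_flow_union[OF assms(1) _ f1 f2 assms(5,6)] by blast
  then show ?thesis using admits_4_flow_of_colour_flow[OF assms(1)] by blast
qed

end
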